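(* As $N\to\infty$ over integers $N\ge 2$, the number of coverage-related nonzero coefficients is $\Theta(N^5)$ in the cell-incidence representation (exact-cover formulation) and $\Theta(N^3)$ in the Corner-Difference MILP (CD-MILP). Moreover, this reduction is obtained without changing the feasible set in the placement variables: for every $N\ge 2$, the set of vectors $x=(x_{i,j,h})_{(i,j,h)\in\mathcal P}$ that extend to a feasible solution $(x,d,c)$ of CD-MILP equals the set of feasible solutions $x$ of the exact-cover formulation.
   Context: Let $N\ge 2$ be an integer. The set of placements is $\mathcal P=\{(i,j,h)\in\mathbb Z^3 : 1\le h\le N-1,\ 1\le i,j\le N-h+1\}$; the triple $(i,j,h)$ represents an $h\times h$ square with upper-left cell $(i,j)$ (row $i$, column $j$) inside the $N\times N$ grid of unit cells $(u,v)$, $1\le u,v\le N$. Exact-cover formulation: minimize $\sum_{(i,j,h)\in\mathcal P}x_{i,j,h}$ subject to $$\sum_{\substack{(i,j,h)\in\mathcal P:\\ i\le u\le i+h-1,\ j\le v\le j+h-1}}x_{i,j,h}=1\quad\text{for all }u,v\in\{1,\dots,N\},\qquad (\mathrm{E})$$ and $x_{i,j,h}\in\{0,1\}$ for all $(i,j,h)\in\mathcal P$. Corner coefficients: for $(i,j,h)\in\mathcal P$ and $1\le p,q\le N+1$, let $\alpha^{p,q}_{i,j,h}=+1$ if $(p,q)=(i,j)$ or $(p,q)=(i+h,j+h)$; $\alpha^{p,q}_{i,j,h}=-1$ if $(p,q)=(i+h,j)$ or $(p,q)=(i,j+h)$; and $\alpha^{p,q}_{i,j,h}=0$ otherwise.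 CD-MILP, in the variables $x_{i,j,h}$ ($(i,j,h)\in\mathcal P$), $d_{p,q}$ ($1\le p,q\le N+1$), $c_{u,v}$ ($0\le u,v\le N$): minimize $\sum_{(i,j,h)\in\mathcal P}x_{i,j,h}$ subject to - (D) $d_{p,q}=\sum_{(i,j,h)\in\mathcal P}\alpha^{p,q}_{i,j,h}\,x_{i,j,h}$ for $1\le p,q\le N+1$; - (P) $c_{u,v}=c_{u-1,v}+c_{u,v-1}-c_{u-1,v-1}+d_{u,v}$ for $1\le u,v\le N$; - (B) $c_{0,v}=0$ for $0\le v\le N$, and $c_{u,0}=0$ for $1\le u\le N$; - (C) $c_{u,v}=1$ for $1\le u,v\le N$; - $d_{p,q}\in\mathbb Z$ for $1\le p,q\le N+1$ and $c_{u,v}\in\mathbb Z$ for $0\le u,v\le N$; - $x_{i,j,h}\in\{0,1\}$ for $(i,j,h)\in\mathcal P$. Counting convention: the coverage-related nonzero coefficients of the exact-cover formulation are the nonzero entries of the placement-to-cell incidence matrix, i.e. of the coefficient matrix of the equations (E). The coverage-related nonzero coefficients of CD-MILP are the nonzero coefficients of the variables $x,d,c$ in the linear equations (D), (P), (B), (C), each written with all variables on one side and each imposed as an explicit row. *)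

theory Defs
  imports Complex_Main "HOL-Library.FuncSet" "HOL-Library.Landau_Symbols"
begin

type_synonym point = "int \<times> int"
type_synonym placement = "int \<times> int \<times> int"

definition placements :: "nat \<Rightarrow> placement set" where
  "placements N = {(i, j, h). 1 \<le> h \<and> h \<le> int N - 1 \<and>
     1 \<le> i \<and> i \<le> int N - h + 1 \<and> 1 \<le> j \<and> j \<le> int N - h + 1}"

definition cells :: "nat \<Rightarrow> point set" where
  "cells N = {1..int N} \<times> {1..int N}"

definition corner_points :: "nat \<Rightarrow> point set" where
  "corner_points N = {1..int N + 1} \<times> {1..int N + 1}"

definition extended_cells :: "nat \<Rightarrow> point set" where
  "extended_cells N = {0..int N} \<times> {0..int N}"

fun covers :: "placement \<Rightarrow> point \<Rightarrow> bool" where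
  "covers (i, j, h) (u, v) \<longleftrightarrow> i \<le> u \<and> u \<le> i + h - 1 \<and> j \<le> v \<and> v \<le> j + h - 1"

text \<open>The number of nonzero entries of the matrix \<open>A\<close> with rows \<open>R\<close> and columns \<open>V\<close>.\<close>

definition nonzeros :: "'r set \<Rightarrow> 'v set \<Rightarrow> ('r \<Rightarrow> 'v \<Rightarrow> real) \<Rightarrow> nat" where
  "nonzeros R V A = card {(r, v) \<in> R \<times> V. A r v \<noteq> 0}"


section \<open>Exact-cover formulation\<close>

text \<open>A vector indexed by a finite set \<open>I\<close> is a function in \<open>I \<rightarrow>\<^sub>E A\<close>. Being \<open>undefined\<close>
  off \<open>I\<close>, it is determined by its entries on \<open>I\<close>, so equality of sets of such
  functions is equality of sets of vectors.\<close>

definition exact_cover_feasible :: "nat \<Rightarrow> (placement \<Rightarrow> real) \<Rightarrow> bool" where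
  "exact_cover_feasible N x \<longleftrightarrow>
     x \<in> placements N \<rightarrow>\<^sub>E {0, 1} \<and>
     (\<forall>w \<in> cells N. (\<Sum>s | s \<in> placements N \<and> covers s w. x s) = 1)"

definition incidence :: "point \<Rightarrow> placement \<Rightarrow> real" where
  "incidence w s = of_bool (covers s w)"

definition exact_cover_nonzeros :: "nat \<Rightarrow> nat" where
  "exact_cover_nonzeros N = nonzeros (cells N) (placements N) incidence"


section \<open>Corner-difference formulation\<close>

fun corner_coeff :: "point \<Rightarrow> placement \<Rightarrow> real" where
  "corner_coeff (p, q) (i, j, h) =
     (if (p, q) = (i, j) \<or> (p, q) = (i + h, j + h) then 1
      else if (p, q) = (i + h, j) \<or> (p, q) = (i, j + h) then - 1
      else 0)"

definition boundary :: "nat \<Rightarrow> point set" where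
  "boundary N = {(0, v) | v. 0 \<le> v \<and> v \<le> int N} \<union> {(u, 0) | u. 1 \<le> u \<and> u \<le> int N}"

definition cd_feasible ::
  "nat \<Rightarrow> (placement \<Rightarrow> real) \<Rightarrow> (point \<Rightarrow> real) \<Rightarrow> (point \<Rightarrow> real) \<Rightarrow> bool" where
  "cd_feasible N x d c \<longleftrightarrow>
     x \<in> placements N \<rightarrow>\<^sub>E {0, 1} \<and>
     d \<in> corner_points N \<rightarrow>\<^sub>E \<int> \<and>
     c \<in> extended_cells N \<rightarrow>\<^sub>E \<int> \<and>
     (\<forall>w \<in> corner_points N. d w = (\<Sum>s \<in> placements N. corner_coeff w s * x s)) \<and>
     (\<forall>(u, v) \<in> cells N. c (u, v) = c (u - 1, v) + c (u, v - 1) - c (u - 1, v - 1) + d (u, v)) \<and>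
     (\<forall>w \<in> boundary N. c w = 0) \<and>
     (\<forall>w \<in> cells N. c w = 1)"

text \<open>The coefficient matrix of the linear equations in \<^const>\<open>cd_feasible\<close>. Its columns are
  the individual variables \<open>x\<^sub>s\<close>, \<open>d\<^sub>w\<close>, \<open>c\<^sub>w\<close>; its rows are the individual equations (difference,
  propagation, boundary, coverage), with all variables moved to the left-hand side.\<close>

datatype cd_var = VarX placement | VarD point | VarC point

datatype cd_row = RowDiff point | RowProp point | RowBoundary point | RowCover point

definition cd_vars :: "nat \<Rightarrow> cd_var set" where
  "cd_vars N = VarX ` placements N \<union> VarD ` corner_points N \<union> VarC ` extended_cells N"

definition cd_rows :: "nat \<Rightarrow> cd_row set" where
  "cd_rows N = RowDiff ` corner_points N \<union> RowProp ` cells N \<union>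
     RowBoundary ` boundary N \<union> RowCover ` cells N"

fun cd_coeff :: "cd_row \<Rightarrow> cd_var \<Rightarrow> real" where
  "cd_coeff (RowDiff w) (VarX s) = - corner_coeff w s"
| "cd_coeff (RowDiff w) (VarD w') = of_bool (w' = w)"
| "cd_coeff (RowDiff w) (VarC w') = 0"
| "cd_coeff (RowProp w) (VarX s) = 0"
| "cd_coeff (RowProp w) (VarD w') = - of_bool (w' = w)"
| "cd_coeff (RowProp (u, v)) (VarC w') =
     of_bool (w' = (u, v)) - of_bool (w' = (u - 1, v)) - of_bool (w' = (u, v - 1))
     + of_bool (w' = (u - 1, v - 1))"
| "cd_coeff (RowBoundary w) (VarC w') = of_bool (w' = w)"
| "cd_coeff (RowBoundary w) _ = 0"
| "cd_coeff (RowCover w) (VarC w') = of_bool (w' = w)"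
| "cd_coeff (RowCover w) _ = 0"

fun cd_rhs :: "cd_row \<Rightarrow> real" where
  "cd_rhs (RowCover w) = 1"
| "cd_rhs _ = 0"

definition cd_nonzeros :: "nat \<Rightarrow> nat" where
  "cd_nonzeros N = nonzeros (cd_rows N) (cd_vars N) cd_coeff"


section \<open>The matrices are those of the equations defining feasibility\<close>

lemma finite_index_sets [simp]:
  "finite (placements N)" "finite (cells N)" "finite (corner_points N)" "finite (extended_cells N)"
proof -
  have "placements N \<subseteq> {0..int N + 1} \<times> {0..int N + 1} \<times> {0..int N + 1}"
    by (auto simp: placements_def)
  then show "finite (placements N)"
    by (rule finite_subset) auto
qed (auto simp: cells_def corner_points_def extended_cells_def)

lemma exact_cover_feasible_iff_matrix:
  "exact_cover_feasible N x \<longleftrightarrow> x \<in> placements N \<rightarrow>\<^sub>E {0, 1} \<and>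
     (\<forall>w \<in> cells N. (\<Sum>s \<in> placements N. incidence w s * x s) = 1)"
proof -
  have "(\<Sum>s | s \<in> placements N \<and> covers s w. x s) = (\<Sum>s \<in> placements N. incidence w s * x s)" for w
    by (rule sum.mono_neutral_cong_left) (auto simp: incidence_def)
  then show ?thesis
    by (simp add: exact_cover_feasible_def)
qed

fun cd_value :: "(placement \<Rightarrow> real) \<Rightarrow> (point \<Rightarrow> real) \<Rightarrow> (point \<Rightarrow> real) \<Rightarrow> cd_var \<Rightarrow> real" where
  "cd_value x d c (VarX s) = x s"
| "cd_value x d c (VarD w) = d w"
| "cd_value x d c (VarC w) = c w"

lemma sum_cd_vars:
  "(\<Sum>y \<in> cd_vars N. f y) = (\<Sum>s \<in> placements N. f (VarX s)) +
     (\<Sum>w \<in> corner_points N. f (VarD w)) + (\<Sum>w \<in> extended_cells N. (f (VarC w) :: real))"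
proof -
  have "(\<Sum>y \<in> cd_vars N. f y) = (\<Sum>y \<in> VarX ` placements N. f y) +
     (\<Sum>y \<in> VarD ` corner_points N. f y) + (\<Sum>y \<in> VarC ` extended_cells N. f y)"
    unfolding cd_vars_def by (subst sum.union_disjoint; (subst sum.union_disjoint)?) auto
  then show ?thesis
    by (simp add: sum.reindex inj_on_def)
qed

lemma sum_of_bool_eq:
  assumes "finite A" "a \<in> A"
  shows "(\<Sum>w \<in> A. of_bool (w = a) * f w) = (f a :: real)"
proof -
  have "(\<Sum>w \<in> A. of_bool (w = a) * f w) = (\<Sum>w \<in> A. if w = a then f w else 0)"
    by (rule sum.cong) auto
  then show ?thesis
    using assms by (simp add: sum.delta)
qed

lemma cd_feasible_iff_matrix:
  "cd_feasible N x d c \<longleftrightarrow>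
     x \<in> placements N \<rightarrow>\<^sub>E {0, 1} \<and>
     d \<in> corner_points N \<rightarrow>\<^sub>E \<int> \<and>
     c \<in> extended_cells N \<rightarrow>\<^sub>E \<int> \<and>
     (\<forall>r \<in> cd_rows N. (\<Sum>y \<in> cd_vars N. cd_coeff r y * cd_value x d c y) = cd_rhs r)"
proof -
  let ?S = "\<lambda>r. \<Sum>y \<in> cd_vars N. cd_coeff r y * cd_value x d c y"
  have D: "?S (RowDiff w) = d w - (\<Sum>s \<in> placements N. corner_coeff w s * x s)"
    if "w \<in> corner_points N" for w
    using that by (simp add: sum_cd_vars sum_of_bool_eq sum_negf)
  have P: "?S (RowProp (u, v)) =
      c (u, v) - c (u - 1, v) - c (u, v - 1) + c (u - 1, v - 1) - d (u, v)"
    if "(u, v) \<in> cells N" for u v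
  proof -
    have "(u, v) \<in> corner_points N" "(u, v) \<in> extended_cells N" "(u - 1, v) \<in> extended_cells N"
      "(u, v - 1) \<in> extended_cells N" "(u - 1, v - 1) \<in> extended_cells N"
      using that by (auto simp: cells_def corner_points_def extended_cells_def)
    then show ?thesis
      by (simp add: sum_cd_vars sum_of_bool_eq sum_negf distrib_right left_diff_distrib
          sum.distrib sum_subtractf del: of_bool_eq_iff)
  qed
  have B: "?S (RowBoundary w) = c w" if "w \<in> boundary N" for w
  proof -
    have "w \<in> extended_cells N"
      using that by (auto simp: boundary_def extended_cells_def)
    then show ?thesis
      by (simp add: sum_cd_vars sum_of_bool_eq)
  qed
  have C: "?S (RowCover w) = c w" if "w \<in> cells N" for w
  proof -
    have "w \<in> extended_cells N"
      using that by (auto simp: cells_def extended_cells_def)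
    then show ?thesis
      by (simp add: sum_cd_vars sum_of_bool_eq)
  qed
  have "(\<forall>r \<in> cd_rows N. ?S r = cd_rhs r) \<longleftrightarrow>
      (\<forall>w \<in> corner_points N. ?S (RowDiff w) = 0) \<and> (\<forall>(u, v) \<in> cells N. ?S (RowProp (u, v)) = 0) \<and>
      (\<forall>w \<in> boundary N. ?S (RowBoundary w) = 0) \<and> (\<forall>w \<in> cells N. ?S (RowCover w) = 1)"
    unfolding cd_rows_def ball_Un by (simp add: ball_simps split_def)
  also have "\<dots> \<longleftrightarrow>
     (\<forall>w \<in> corner_points N. d w = (\<Sum>s \<in> placements N. corner_coeff w s * x s)) \<and>
     (\<forall>(u, v) \<in> cells N. c (u, v) = c (u - 1, v) + c (u, v - 1) - c (u - 1, v - 1) + d (u, v)) \<and>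
     (\<forall>w \<in> boundary N. c w = 0) \<and> (\<forall>w \<in> cells N. c w = 1)"
  proof (intro arg_cong2 [where f = "(\<and>)"] ball_cong refl)
    fix w assume "w \<in> cells N"
    moreover obtain u v where "w = (u, v)"
      by (cases w)
    ultimately show "(case w of (u, v) \<Rightarrow> ?S (RowProp (u, v)) = 0) \<longleftrightarrow>
      (case w of (u, v) \<Rightarrow> c (u, v) = c (u - 1, v) + c (u, v - 1) - c (u - 1, v - 1) + d (u, v))"
      using P [of u v] by (simp only: prod.case) linarith
  qed (use D B C in auto)
  finally show ?thesis
    unfolding cd_feasible_def by blast
qed

end

theory Submission
  imports Defs
begin

text \<open>
  Counting. The nonzeros of the exact-cover matrix are the pairs of a cell and a placement that
  covers it. There are at most \<open>N\<^sup>2\<close> cells and \<open>N\<^sup>3\<close> placements, hence at most \<open>N\<^sup>5\<close> pairs. This is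
  the true order because a whole five-dimensional box of index tuples consists of such pairs
  (\<open>covered_box\<close>): squares with sides roughly between \<open>N/2\<close> and \<open>3N/4\<close>, anchored near the upper-left corner of the
  grid, all cover a common block of about \<open>(N/4)\<^sup>2\<close> cells. In the corner-difference matrix a square enters
  only through its four corners, and every column has at most six nonzeros
  (\<open>cd_column_sparse\<close>), so their total number is at most six times the number of variables, which
  is \<open>O(N\<^sup>3)\<close>. Conversely each of the order \<open>N\<^sup>3\<close> placements does meet the row of its upper-left
  corner.

  Feasibility. The corner coefficient of a square is the mixed second difference of its indicator
  function (\<open>corner_coeff_eq_mixed_difference\<close>). By linearity, the corner sums \<open>d\<close> are the mixed
  differences of the coverage, the function that counts how often a cell is covered.
  The coverage vanishes on row 0 and on column 0, and a function that vanishes there is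
  determined by its mixed differences (\<open>zero_from_mixed_difference\<close>). So the propagated
  values \<open>c\<close> are forced to be the coverage, and requiring \<open>c = 1\<close> on the cells is exact covering.
\<close>

section \<open>Nonzeros of the exact-cover matrix\<close>

lemma card_placements_le: "card (placements N) \<le> N ^ 3"
proof -
  have "placements N \<subseteq> {1..int N} \<times> {1..int N} \<times> {1..int N}"
    by (auto simp: placements_def)
  then have "card (placements N) \<le> card ({1..int N} \<times> {1..int N} \<times> {1..int N})"
    by (rule card_mono[rotated]) auto
  then show ?thesis
    by (simp add: card_cartesian_product power3_eq_cube)
qed

lemma exact_cover_nonzeros_le: "exact_cover_nonzeros N \<le> N ^ 5"
proof -
  have "exact_cover_nonzeros N \<le> card (cells N \<times> placements N)"
    unfolding exact_cover_nonzeros_def nonzeros_def by (rule card_mono) auto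
  also have "\<dots> = N ^ 2 * card (placements N)"
    by (simp add: card_cartesian_product cells_def power2_eq_square)
  also have "\<dots> \<le> N ^ 2 * N ^ 3"
    using card_placements_le by (rule mult_left_mono) simp
  also have "\<dots> = N ^ 5"
    by (simp flip: power_add)
  finally show ?thesis .
qed

text \<open>An upper-left corner in \<open>{1..k}\<^sup>2\<close> and a side above \<open>2k\<close> force a square to contain the block
  \<open>{k<..2k}\<^sup>2\<close>, and a side of at most \<open>3k\<close> keeps it inside the grid since \<open>4k \<le> N\<close>.\<close>

lemma covered_box:
  fixes N :: nat and k :: int
  assumes "4 * k \<le> int N"
  shows "{1..k} \<times> {1..k} \<times> {2 * k<..3 * k} \<subseteq> placements N"
    and "{k<..2 * k} \<times> {k<..2 * k} \<subseteq> cells N"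
    and "s \<in> {1..k} \<times> {1..k} \<times> {2 * k<..3 * k} \<Longrightarrow> w \<in> {k<..2 * k} \<times> {k<..2 * k} \<Longrightarrow> covers s w"
  using assms by (auto simp: placements_def cells_def)

lemma card_placements_ge: "(N div 4) ^ 3 \<le> card (placements N)"
proof -
  define k where "k = int (N div 4)"
  have "card ({1..k} \<times> {1..k} \<times> {2 * k<..3 * k}) \<le> card (placements N)"
    by (rule card_mono[OF _ covered_box(1)]) (auto simp: k_def)
  then show ?thesis
    by (simp add: card_cartesian_product power3_eq_cube k_def)
qed

lemma exact_cover_nonzeros_ge: "(N div 4) ^ 5 \<le> exact_cover_nonzeros N"
proof -
  define k where "k = int (N div 4)"
  define S where "S = {1..k} \<times> {1..k} \<times> {2 * k<..3 * k}"
  define W where "W = {k<..2 * k} \<times> {k<..2 * k}"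
  have "4 * k \<le> int N"
    by (simp add: k_def)
  note box = covered_box[OF this, folded S_def W_def]
  have "(N div 4) ^ 5 = (N div 4) ^ 2 * (N div 4) ^ 3"
    by (simp flip: power_add)
  also have "\<dots> = card (W \<times> S)"
    by (simp add: card_cartesian_product S_def W_def k_def power2_eq_square power3_eq_cube)
  also have "\<dots> \<le> exact_cover_nonzeros N"
    unfolding exact_cover_nonzeros_def nonzeros_def
  proof (rule card_mono)
    show "finite {(w, s) \<in> cells N \<times> placements N. incidence w s \<noteq> 0}"
      by (rule finite_subset[of _ "cells N \<times> placements N"]) auto
    show "W \<times> S \<subseteq> {(w, s) \<in> cells N \<times> placements N. incidence w s \<noteq> 0}"
      using box by (auto simp: incidence_def)
  qed
  finally show ?thesis .
qed


section \<open>Nonzeros of the corner-difference matrix\<close>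

lemma nonzeros_le_of_sparse_columns:
  assumes "finite V"
    and "\<And>v. v \<in> V \<Longrightarrow> finite (T v) \<and> card (T v) \<le> m"
    and "\<And>r v. v \<in> V \<Longrightarrow> A r v \<noteq> 0 \<Longrightarrow> r \<in> T v"
  shows "nonzeros R V A \<le> m * card V"
proof -
  have "nonzeros R V A \<le> card ((\<lambda>(v, r). (r, v)) ` (SIGMA v:V. T v))"
    unfolding nonzeros_def using assms by (intro card_mono finite_imageI finite_SigmaI) force+
  also have "\<dots> \<le> card (SIGMA v:V. T v)"
    using assms by (intro card_image_le finite_SigmaI) auto
  also have "\<dots> = (\<Sum>v\<in>V. card (T v))"
    using assms by (intro card_SigmaI) auto
  also have "\<dots> \<le> (\<Sum>v\<in>V. m)"
    using assms by (intro sum_mono) auto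
  finally show ?thesis
    by (simp add: mult.commute)
qed

text \<open>The rows that can be nonzero in the column of a variable. They form a list because the number
  of its distinct entries is at most its length, whichever of the entries coincide.\<close>

fun cd_support :: "cd_var \<Rightarrow> cd_row list" where
  "cd_support (VarX (i, j, h)) =
     [RowDiff (i, j), RowDiff (i + h, j + h), RowDiff (i + h, j), RowDiff (i, j + h)]"
| "cd_support (VarD w) = [RowDiff w, RowProp w]"
| "cd_support (VarC (u, v)) =
     [RowProp (u, v), RowProp (u + 1, v), RowProp (u, v + 1), RowProp (u + 1, v + 1),
      RowBoundary (u, v), RowCover (u, v)]"

lemma length_cd_support_le: "length (cd_support y) \<le> 6"
  by (cases y rule: cd_support.cases) auto

lemma cd_column_sparse:
  assumes "cd_coeff r y \<noteq> 0"
  shows "r \<in> set (cd_support y)"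
  using assms
  by (cases y rule: cd_support.cases; cases r) (auto split: if_splits)

lemma finite_cd_vars: "finite (cd_vars N)"
  by (simp add: cd_vars_def)

lemma card_cd_vars_le: "card (cd_vars N) \<le> N ^ 3 + 2 * (N + 1) ^ 2"
proof -
  have "card (cd_vars N) \<le>
      card (VarX ` placements N) + card (VarD ` corner_points N) + card (VarC ` extended_cells N)"
    unfolding cd_vars_def by (meson add_le_mono1 card_Un_le le_trans)
  also have "\<dots> = card (placements N) + card (corner_points N) + card (extended_cells N)"
    by (simp add: card_image inj_on_def)
  also have "\<dots> = card (placements N) + 2 * (N + 1) ^ 2"
    by (simp add: corner_points_def extended_cells_def card_cartesian_product power2_eq_square
        nat_add_distrib)
  finally show ?thesis
    using card_placements_le[of N] by linarith
qed

lemma cd_nonzeros_le: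
  assumes "N \<ge> 1"
  shows "cd_nonzeros N \<le> 54 * N ^ 3"
proof -
  have "cd_nonzeros N \<le> 6 * card (cd_vars N)"
    unfolding cd_nonzeros_def
  proof (rule nonzeros_le_of_sparse_columns)
    show "finite (set (cd_support y)) \<and> card (set (cd_support y)) \<le> 6" for y
      using le_trans[OF card_length length_cd_support_le] by simp
  qed (use finite_cd_vars cd_column_sparse in auto)
  also have "\<dots> \<le> 6 * (N ^ 3 + 2 * (N + 1) ^ 2)"
    using card_cd_vars_le by (rule mult_left_mono) simp
  also have "\<dots> \<le> 6 * (N ^ 3 + 2 * (2 * N) ^ 2)"
    using assms by (intro mult_left_mono add_left_mono power_mono) auto
  also have "\<dots> = 6 * N ^ 3 + 48 * N ^ 2 * 1"
    by (simp add: power2_eq_square)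
  also have "\<dots> \<le> 6 * N ^ 3 + 48 * N ^ 2 * N"
    using assms by (intro add_left_mono mult_left_mono) auto
  also have "\<dots> = 54 * N ^ 3"
    by (simp add: power2_eq_square power3_eq_cube)
  finally show ?thesis .
qed

lemma cd_nonzeros_ge: "card (placements N) \<le> cd_nonzeros N"
proof -
  define e where "e = (\<lambda>(i, j, h). (RowDiff (i, j), VarX (i, j, h)))"
  let ?E = "{(r, y) \<in> cd_rows N \<times> cd_vars N. cd_coeff r y \<noteq> 0}"
  have "finite (boundary N)"
    by (rule finite_subset[of _ "extended_cells N"]) (auto simp: boundary_def extended_cells_def)
  then have "finite (cd_rows N)"
    by (simp add: cd_rows_def)
  then have "finite ?E"
    by (intro finite_subset[of ?E "cd_rows N \<times> cd_vars N"]) (auto simp: finite_cd_vars)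
  moreover have "inj_on e (placements N)"
    by (auto simp: inj_on_def e_def)
  moreover have "e ` placements N \<subseteq> ?E"
    by (auto simp: e_def cd_rows_def cd_vars_def placements_def corner_points_def)
  ultimately show ?thesis
    unfolding cd_nonzeros_def nonzeros_def by (intro card_inj_on_le)
qed


section \<open>Asymptotics\<close>

lemma bigtheta_power_of_quarter_bounds:
  fixes f :: "nat \<Rightarrow> nat" and C :: real
  assumes lower: "\<And>N. (N div 4) ^ m \<le> f N"
    and upper: "\<And>N. N \<ge> 1 \<Longrightarrow> real (f N) \<le> C * real N ^ m"
  shows "(\<lambda>N. real (f N)) \<in> \<Theta>(\<lambda>N. real N ^ m)"
proof (rule bigthetaI)
  show "(\<lambda>N. real (f N)) \<in> O(\<lambda>N. real N ^ m)"
    by (rule bigoI[of _ C]) (use upper in \<open>auto simp: eventually_at_top_linorder\<close>)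
  have "(1 / 8) ^ m * real N ^ m \<le> real (f N)" if "N \<ge> 4" for N
  proof -
    have "N \<le> 8 * (N div 4)"
      using that by presburger
    then have "real N \<le> real (8 * (N div 4))"
      by (simp only: of_nat_le_iff)
    then have "real N / 8 \<le> real (N div 4)"
      by simp
    then have "(real N / 8) ^ m \<le> real (N div 4) ^ m"
      by (rule power_mono) simp
    also have "\<dots> \<le> real (f N)"
      using lower[of N] by (metis of_nat_le_iff of_nat_power)
    finally show ?thesis
      by (simp add: power_divide)
  qed
  then show "(\<lambda>N. real (f N)) \<in> \<Omega>(\<lambda>N. real N ^ m)"
    by (intro landau_omega.bigI[of "(1 / 8) ^ m"]) (auto simp: eventually_at_top_linorder)
qed


section \<open>Equality of the feasible sets\<close>

definition coverage :: "nat \<Rightarrow> (placement \<Rightarrow> real) \<Rightarrow> point \<Rightarrow> real" where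
  "coverage N x w = (\<Sum>s \<in> placements N. incidence w s * x s)"

definition corner_sum :: "nat \<Rightarrow> (placement \<Rightarrow> real) \<Rightarrow> point \<Rightarrow> real" where
  "corner_sum N x w = (\<Sum>s \<in> placements N. corner_coeff w s * x s)"

text \<open>The indicator of a square is the product of the indicators of two intervals, and the difference
  of an interval's indicator is \<open>+1\<close> at its start, \<open>-1\<close> just after its end. The side must be positive:
  for \<open>h = 0\<close> the four corners coincide and the coefficient is 1, not 0.\<close>

lemma corner_coeff_eq_mixed_difference:
  assumes "h \<ge> 1"
  shows "corner_coeff (u, v) (i, j, h) =
    incidence (u, v) (i, j, h) - incidence (u - 1, v) (i, j, h)
      - incidence (u, v - 1) (i, j, h) + incidence (u - 1, v - 1) (i, j, h)"
proof -
  define I where "I a t = (of_bool (a \<le> t \<and> t \<le> a + h - 1) :: real)" for a t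
  have I_diff: "I a t - I a (t - 1) = of_bool (t = a) - of_bool (t = a + h)" for a t
    using assms by (auto simp: I_def)
  have "corner_coeff (u, v) (i, j, h) =
      (of_bool (u = i) - of_bool (u = i + h)) * (of_bool (v = j) - of_bool (v = j + h))"
    using assms by auto
  also have "\<dots> = (I i u - I i (u - 1)) * (I j v - I j (v - 1))"
    by (simp only: I_diff)
  also have "\<dots> = I i u * I j v - I i (u - 1) * I j v - I i u * I j (v - 1) + I i (u - 1) * I j (v - 1)"
    by (simp only: algebra_simps)
  finally have "corner_coeff (u, v) (i, j, h) =
      I i u * I j v - I i (u - 1) * I j v - I i u * I j (v - 1) + I i (u - 1) * I j (v - 1)" .
  moreover have "incidence (a, b) (i, j, h) = I i a * I j b" for a b
    by (auto simp: I_def incidence_def)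
  ultimately show ?thesis
    by (simp only:)
qed

lemma corner_sum_eq_mixed_difference:
  "corner_sum N x (u, v) = coverage N x (u, v) - coverage N x (u - 1, v)
     - coverage N x (u, v - 1) + coverage N x (u - 1, v - 1)"
proof -
  have "corner_coeff (u, v) s * x s = incidence (u, v) s * x s - incidence (u - 1, v) s * x s
      - incidence (u, v - 1) s * x s + incidence (u - 1, v - 1) s * x s"
    if "s \<in> placements N" for s
  proof -
    obtain i j h where s: "s = (i, j, h)"
      by (cases s)
    with that have "h \<ge> 1"
      by (simp add: placements_def)
    then show ?thesis
      unfolding s by (simp only: corner_coeff_eq_mixed_difference algebra_simps)
  qed
  then show ?thesis
    by (simp add: corner_sum_def coverage_def sum.distrib sum_subtractf)
qed

lemma coverage_boundary: "w \<in> boundary N \<Longrightarrow> coverage N x w = 0"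
  unfolding coverage_def
  by (rule sum.neutral) (auto simp: boundary_def placements_def incidence_def)

lemma corner_sum_Ints:
  assumes "x \<in> placements N \<rightarrow>\<^sub>E {0, 1}"
  shows "corner_sum N x w \<in> \<int>"
proof -
  have "corner_coeff w s \<in> \<int>" for s
    by (cases "(w, s)" rule: corner_coeff.cases) auto
  moreover have "x s \<in> \<int>" if "s \<in> placements N" for s
    using assms that by (auto dest!: PiE_mem)
  ultimately show ?thesis
    unfolding corner_sum_def by (intro Ints_sum Ints_mult)
qed

lemma zero_from_mixed_difference:
  fixes f :: "point \<Rightarrow> real"
  assumes bd: "\<And>w. w \<in> boundary N \<Longrightarrow> f w = 0"
    and step: "\<And>u v. (u, v) \<in> cells N \<Longrightarrow> f (u, v) = f (u - 1, v) + f (u, v - 1) - f (u - 1, v - 1)"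
  shows "(u, v) \<in> extended_cells N \<Longrightarrow> f (u, v) = 0"
proof (induction "nat (u + v)" arbitrary: u v rule: less_induct)
  case less
  show ?case
  proof (cases "u = 0 \<or> v = 0")
    case True
    with less.prems have "(u, v) \<in> boundary N"
      by (auto simp: boundary_def extended_cells_def)
    then show ?thesis
      by (rule bd)
  next
    case False
    with less.prems have "(u, v) \<in> cells N"
      by (auto simp: cells_def extended_cells_def)
    moreover have "f (u - 1, v) = 0" "f (u, v - 1) = 0" "f (u - 1, v - 1) = 0"
      using False less.prems by (auto intro!: less.hyps simp: extended_cells_def)
    ultimately show ?thesis
      by (simp add: step)
  qed
qed

lemma exact_cover_feasible_iff_coverage:
  "exact_cover_feasible N x \<longleftrightarrow>
     x \<in> placements N \<rightarrow>\<^sub>E {0, 1} \<and> (\<forall>w \<in> cells N. coverage N x w = 1)"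
  by (simp add: exact_cover_feasible_iff_matrix coverage_def)

lemma cd_feasible_imp_exact_cover:
  assumes "cd_feasible N x d c"
  shows "exact_cover_feasible N x"
proof -
  have "coverage N x (u, v) = 1" if w: "(u, v) \<in> cells N" for u v
  proof -
    have "c (u, v) - coverage N x (u, v) = 0"
    proof (rule zero_from_mixed_difference[where f = "\<lambda>w. c w - coverage N x w" and N = N])
      show "c w - coverage N x w = 0" if "w \<in> boundary N" for w
        using that assms by (simp add: cd_feasible_def coverage_boundary)
      fix p q assume pq: "(p, q) \<in> cells N"
      then have "(p, q) \<in> corner_points N"
        by (auto simp: cells_def corner_points_def)
      then have "d (p, q) = corner_sum N x (p, q)"
        using assms by (simp only: cd_feasible_def corner_sum_def)
      moreover have "c (p, q) = c (p - 1, q) + c (p, q - 1) - c (p - 1, q - 1) + d (p, q)"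
        using pq assms by (auto simp: cd_feasible_def)
      ultimately show "c (p, q) - coverage N x (p, q) =
          c (p - 1, q) - coverage N x (p - 1, q) + (c (p, q - 1) - coverage N x (p, q - 1))
            - (c (p - 1, q - 1) - coverage N x (p - 1, q - 1))"
        by (simp add: corner_sum_eq_mixed_difference)
    qed (use w in \<open>auto simp: cells_def extended_cells_def\<close>)
    moreover have "c (u, v) = 1"
      using w assms by (simp add: cd_feasible_def)
    ultimately show ?thesis
      by simp
  qed
  then show ?thesis
    using assms by (auto simp: exact_cover_feasible_iff_coverage cd_feasible_def)
qed

lemma exact_cover_imp_cd_feasible:
  assumes "exact_cover_feasible N x"
  shows "cd_feasible N x (restrict (corner_sum N x) (corner_points N))
    (restrict (coverage N x) (extended_cells N))"
proof -
  let ?c = "restrict (coverage N x) (extended_cells N)"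
  have x: "x \<in> placements N \<rightarrow>\<^sub>E {0, 1}" and cov: "\<And>w. w \<in> cells N \<Longrightarrow> coverage N x w = 1"
    using assms by (auto simp: exact_cover_feasible_iff_coverage)
  have sub: "cells N \<subseteq> extended_cells N" "boundary N \<subseteq> extended_cells N" "cells N \<subseteq> corner_points N"
    by (auto simp: cells_def boundary_def extended_cells_def corner_points_def)
  have split: "extended_cells N \<subseteq> boundary N \<union> cells N"
    by (auto simp: cells_def boundary_def extended_cells_def)
  have c_Ints: "?c \<in> extended_cells N \<rightarrow>\<^sub>E \<int>"
    using split cov coverage_boundary by fastforce
  have "?c (u, v) = ?c (u - 1, v) + ?c (u, v - 1) - ?c (u - 1, v - 1) + corner_sum N x (u, v)"
    if "(u, v) \<in> cells N" for u v
  proof -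
    have "(u, v) \<in> extended_cells N" "(u - 1, v) \<in> extended_cells N"
      "(u, v - 1) \<in> extended_cells N" "(u - 1, v - 1) \<in> extended_cells N"
      using that by (auto simp: cells_def extended_cells_def)
    then show ?thesis
      by (simp add: corner_sum_eq_mixed_difference)
  qed
  moreover have "?c w = 0" if "w \<in> boundary N" for w
    using that sub coverage_boundary by (auto simp: restrict_def)
  moreover have "?c w = 1" if "w \<in> cells N" for w
    using that sub cov by (auto simp: restrict_def)
  ultimately show ?thesis
    unfolding cd_feasible_def
    using x c_Ints sub(3) corner_sum_Ints[OF x]
    by (auto simp: corner_sum_def[symmetric] subset_iff simp del: restrict_apply
        intro!: restrict_PiE) (auto simp: corner_sum_def)
qed

theorem proposition3:
  "(\<lambda>N. real (exact_cover_nonzeros N)) \<in> \<Theta>(\<lambda>N. real N ^ 5) \<and>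
   (\<lambda>N. real (cd_nonzeros N)) \<in> \<Theta>(\<lambda>N. real N ^ 3) \<and>
   (\<forall>N \<ge> 2. {x. \<exists>d c. cd_feasible N x d c} = {x. exact_cover_feasible N x})"
proof (intro conjI allI impI)
  show "(\<lambda>N. real (exact_cover_nonzeros N)) \<in> \<Theta>(\<lambda>N. real N ^ 5)"
  proof (rule bigtheta_power_of_quarter_bounds[OF exact_cover_nonzeros_ge, where C = 1])
    show "real (exact_cover_nonzeros N) \<le> 1 * real N ^ 5" for N
      using of_nat_mono[OF exact_cover_nonzeros_le[of N], where 'a = real] by simp
  qed
  show "(\<lambda>N. real (cd_nonzeros N)) \<in> \<Theta>(\<lambda>N. real N ^ 3)"
  proof (rule bigtheta_power_of_quarter_bounds[where C = 54])
    show "(N div 4) ^ 3 \<le> cd_nonzeros N" for N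
      using card_placements_ge cd_nonzeros_ge by (rule le_trans)
    show "real (cd_nonzeros N) \<le> 54 * real N ^ 3" if "N \<ge> 1" for N
      using of_nat_mono[OF cd_nonzeros_le[OF that], where 'a = real] by simp
  qed
  show "{x. \<exists>d c. cd_feasible N x d c} = {x. exact_cover_feasible N x}" for N
    using cd_feasible_imp_exact_cover exact_cover_imp_cd_feasible by blast
qed

end
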